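(* Suppose the lion plays the Moving Center Lion Strategy, and let $t$ be a time such that the game has not ended after the moves leading to the positions $M_{t+1},L_{t+1}$ (so that the centers $C_t$ and $C_{t+1}$ are both defined). If $m_t>1$, then, for any possible man strategy, $$m_{t+1}\le \frac{m_t(m_t-1)}{\sqrt{1+m_t^2}-1}.$$
   Context: Game. Two players, a man and a lion, occupy points $M_t,L_t\in\mathbb{R}^2_+$ (the closed non-negative quadrant) at times $t=0,1,2,\dots$. In each round the man moves first, from $M_t$ to any $M_{t+1}\in\mathbb{R}^2_+$ with $\|M_{t+1}-M_t\|\le 1$; then the lion moves from $L_t$ to $L_{t+1}\in\mathbb{R}^2_+$ with $\|L_{t+1}-L_t\|\le 1$ (Euclidean norm). The game ends (the lion captures the man) if the lion moves exactly to the man's position. Standing assumption: both coordinates of $M_0$ are strictly smaller than the corresponding coordinates of $L_0$. Center. Given $M_t,L_t$ (game not ended), the center at time $t$ is the point $C_t=[x_t,y_t]'\in\mathbb{R}^2_+$ such that $C_t=L_t+\eta(L_t-M_t)$ for some $\eta>0$ and $\|C_t-L_t\|=\max\{x_t,y_t\}$. Put $m_t=\min\{x_t,y_t\}$. Moving Center Lion Strategy (MCLS). When the man moves from $M_t$ to $M_{t+1}$: the lion computes the center $C_t$ from $M_t$ and $L_t$; if $\|M_{t+1}-L_t\|\le 1$, the lion moves to $M_{t+1}$ and captures the man; otherwise the lion moves to a point $L_{t+1}$ on the line through $M_{t+1}$ and $C_t$ with $\|L_{t+1}-L_t\|=1$, choosing, of the two such points, the one farther from $C_t$. *)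

theory Defs
  imports "HOL-Analysis.Analysis"
begin

definition quadrant :: "(real^2) set" where
  "quadrant = {P. 0 \<le> P $ 1 \<and> 0 \<le> P $ 2}"

text \<open>A run is recorded as infinite sequences of positions \<open>M\<close>, \<open>L\<close>; \<open>legal_run M L n\<close> only
  constrains the positions up to time \<open>n\<close>, so what the sequences do after a capture is irrelevant.\<close>

definition legal_run :: "(nat \<Rightarrow> real^2) \<Rightarrow> (nat \<Rightarrow> real^2) \<Rightarrow> nat \<Rightarrow> bool" where
  "legal_run M L n \<longleftrightarrow>
     (\<forall>s\<le>n. M s \<in> quadrant \<and> L s \<in> quadrant) \<and>
     (\<forall>s<n. norm (M (Suc s) - M s) \<le> 1 \<and> norm (L (Suc s) - L s) \<le> 1)"

definition admissible_start :: "real^2 \<Rightarrow> real^2 \<Rightarrow> bool" where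
  "admissible_start M0 L0 \<longleftrightarrow> M0 $ 1 < L0 $ 1 \<and> M0 $ 2 < L0 $ 2"

definition not_ended :: "(nat \<Rightarrow> real^2) \<Rightarrow> (nat \<Rightarrow> real^2) \<Rightarrow> nat \<Rightarrow> bool" where
  "not_ended M L n \<longleftrightarrow> (\<forall>s\<le>n. L s \<noteq> M s)"

definition is_center :: "real^2 \<Rightarrow> real^2 \<Rightarrow> real^2 \<Rightarrow> bool" where
  "is_center M L C \<longleftrightarrow>
     C \<in> quadrant \<and>
     (\<exists>\<eta>>0. C = L + \<eta> *\<^sub>R (L - M)) \<and>
     norm (C - L) = max (C $ 1) (C $ 2)"

definition center :: "real^2 \<Rightarrow> real^2 \<Rightarrow> real^2" where
  "center M L = (THE C. is_center M L C)"

text \<open>The description is proper whenever the man is strictly below and to the left of the lion.\<close>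

lemma ex1_is_center:
  assumes "M \<in> quadrant" and "M $ 1 < L $ 1" and "M $ 2 < L $ 2"
  shows "\<exists>!C. is_center M L C"
proof -
  define d a b where "d = norm (L - M)" and "a = L $ 1 - M $ 1" and "b = L $ 2 - M $ 2"
  define \<eta> where "\<eta> = max (L $ 1 / (d - a)) (L $ 2 / (d - b))"
  have ab: "0 < a" "0 < b" and L: "0 < L $ 1" "0 < L $ 2"
    using assms by (auto simp: a_def b_def quadrant_def)
  have d: "d = sqrt (a\<^sup>2 + b\<^sup>2)"
    by (simp add: d_def a_def b_def norm_vec_def L2_set_def UNIV_2)
  have lt: "a < d" "b < d"
    using ab by (auto simp: d intro!: real_less_rsqrt)
  have crit: "is_center M L (L + e *\<^sub>R (L - M)) \<longleftrightarrow> e = \<eta>" if "e > 0" for e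
  proof -
    have "is_center M L (L + e *\<^sub>R (L - M)) \<longleftrightarrow>
        e * d = max (L $ 1 + e * a) (L $ 2 + e * b)"
    proof -
      have "L + e *\<^sub>R (L - M) \<in> quadrant"
        using that ab L by (auto simp: quadrant_def a_def b_def)
      moreover have "norm (L + e *\<^sub>R (L - M) - L) = e * d"
        using that by (simp add: d_def)
      ultimately show ?thesis
        using that by (auto simp: is_center_def a_def b_def)
    qed
    also have "\<dots> \<longleftrightarrow> e = \<eta>"
    proof -
      have eq_max: "z = max x y \<longleftrightarrow> x \<le> z \<and> y \<le> z \<and> (x = z \<or> y = z)" for x y z :: real
        by (auto simp: max_def)
      have le: "L $ 1 + e * a \<le> e * d \<longleftrightarrow> L $ 1 / (d - a) \<le> e"
          "L $ 2 + e * b \<le> e * d \<longleftrightarrow> L $ 2 / (d - b) \<le> e"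
        using lt by (auto simp: pos_divide_le_eq right_diff_distrib)
      have eq: "L $ 1 + e * a = e * d \<longleftrightarrow> L $ 1 / (d - a) = e"
          "L $ 2 + e * b = e * d \<longleftrightarrow> L $ 2 / (d - b) = e"
        using lt by (auto simp: divide_eq_eq right_diff_distrib)
      show ?thesis
        unfolding \<eta>_def eq_max le eq ..
    qed
    finally show ?thesis .
  qed
  have "\<eta> > 0"
    using lt L by (auto simp: \<eta>_def less_max_iff_disj)
  show ?thesis
  proof (rule ex1I)
    show "is_center M L (L + \<eta> *\<^sub>R (L - M))"
      using crit \<open>\<eta> > 0\<close> by blast
  next
    fix C assume C: "is_center M L C"
    then obtain e where "e > 0" "C = L + e *\<^sub>R (L - M)"
      by (auto simp: is_center_def)
    with C crit show "C = L + \<eta> *\<^sub>R (L - M)"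
      by blast
  qed
qed

text \<open>\<open>mcls_response M L M' L'\<close>: from positions \<open>M\<close>, \<open>L\<close>, when the man moves to \<open>M'\<close>,
  the Moving Center Lion Strategy allows the lion to move to \<open>L'\<close>.\<close>

definition mcls_response :: "real^2 \<Rightarrow> real^2 \<Rightarrow> real^2 \<Rightarrow> real^2 \<Rightarrow> bool" where
  "mcls_response M L M' L' \<longleftrightarrow>
     (if norm (M' - L) \<le> 1 then L' = M'
      else let C = center M L; S = {P \<in> affine hull {M', C}. norm (P - L) = 1}
           in L' \<in> S \<and> (\<forall>P\<in>S. dist P C \<le> dist L' C))"

definition lion_plays_mcls :: "(nat \<Rightarrow> real^2) \<Rightarrow> (nat \<Rightarrow> real^2) \<Rightarrow> nat \<Rightarrow> bool" where
  "lion_plays_mcls M L n \<longleftrightarrow>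
     (\<forall>s<n. mcls_response (M s) (L s) (M (Suc s)) (L (Suc s)))"

definition center_min :: "(nat \<Rightarrow> real^2) \<Rightarrow> (nat \<Rightarrow> real^2) \<Rightarrow> nat \<Rightarrow> real" where
  "center_min M L s = min (center (M s) (L s) $ 1) (center (M s) (L s) $ 2)"

end

theory Submission
  imports Defs
begin

text \<open>
  Let \<open>C\<close> be the center at time \<open>t\<close> and \<open>r = \<parallel>C - L\<parallel> = max x y\<close>. Since the man is nearer to his old
  position than to the lion after his move, while escaping the unit disc around the lion, the lion's new
  position \<open>L'\<close> lies between \<open>C\<close> and \<open>M'\<close>, and its step has a positive component along \<open>L - C\<close>;
  hence \<open>\<rho> = \<parallel>C - L'\<parallel>\<close> satisfies \<open>\<rho>\<^sup>2 \<ge> 1 + r\<^sup>2\<close>. The same estimates show that \<open>M'\<close> is strictly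
  below and to the left of \<open>C\<close>, which preserves the relative position of man and lion.

  The new center is \<open>C - \<sigma> v\<close> with \<open>v\<close> the unit vector of \<open>C - L'\<close> and
  \<open>\<rho> - \<sigma> = max (x - \<sigma> v\<^sub>1) (y - \<sigma> v\<^sub>2)\<close>. If, say, the first coordinate attains the maximum, then
  \<open>\<sigma> v\<^sub>2 = (\<rho> - x) v\<^sub>2 / (1 - v\<^sub>1)\<close>, and \<open>v\<^sub>2 / (1 - v\<^sub>1)\<close> is the cotangent of half the angle of \<open>v\<close>, which
  is least when \<open>v\<^sub>2\<close> is as large as \<open>L' \<in> quadrant\<close> permits, namely \<open>\<rho> v\<^sub>2 = y\<close>. The resulting bound is
  weakest for \<open>\<rho>\<^sup>2 = 1 + r\<^sup>2\<close> and \<open>x = y\<close>, where it equals the asserted one.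
\<close>

section \<open>Scalar estimates for the smaller coordinate of the new center\<close>

lemma mult_div_sqrt_minus_one:
  fixes b :: real
  assumes "b > 0"
  shows "b * (b - 1) / (sqrt (1 + b\<^sup>2) - 1) = (b - 1) * (sqrt (1 + b\<^sup>2) + 1) / b"
proof -
  have "sqrt (1 + b\<^sup>2) > 1" using assms by simp
  moreover have "(sqrt (1 + b\<^sup>2))\<^sup>2 = 1 + b\<^sup>2" by (simp add: add_nonneg_nonneg)
  ultimately show ?thesis
    using assms by (simp add: divide_simps) (simp add: power2_eq_square algebra_simps)
qed

text \<open>Here \<open>a\<close> is the coordinate attaining the maximum, which fixes
  \<open>\<sigma>\<close>. Since 1 - p^2 = q^2, the shift \<open>\<sigma> * q\<close> equals (\<rho>
  - a)(\<rho> + \<rho> p) / (\<rho> q). Each factor is then replaced by its worst case: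
  \<open>\<rho>\<close> by the root of 1 + r^2, \<open>\<rho> * q\<close> by \<open>b\<close>, and
  \<open>\<rho> * p\<close> by the leg that these two leave.\<close>

lemma tangent_half_angle_bound:
  fixes \<rho> \<sigma> a b p q :: real
  assumes "p > 0" "q > 0" "p\<^sup>2 + q\<^sup>2 = 1" "\<rho> > 0" "b > 0" "\<rho> * q \<le> b" "b \<le> r" "a \<le> r"
    and "1 + r\<^sup>2 \<le> \<rho>\<^sup>2" "\<sigma> * (1 - p) = \<rho> - a"
  shows "b - \<sigma> * q \<le> b - (sqrt (1 + r\<^sup>2) - a) * (sqrt (1 + r\<^sup>2) + sqrt (1 + r\<^sup>2 - b\<^sup>2)) / b"
proof -
  define R where "R = sqrt (1 + r\<^sup>2)"
  define s where "s = sqrt (1 + r\<^sup>2 - b\<^sup>2)"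
  have "R \<le> \<rho>" unfolding R_def using assms by (intro real_le_lsqrt) auto
  moreover have "r < R" unfolding R_def by (rule real_less_rsqrt) simp
  ultimately have R: "R \<le> \<rho>" "a < R" "R > 0" using assms by linarith+
  have b2: "b\<^sup>2 \<le> r\<^sup>2" using assms by (simp add: power_mono)
  then have s0: "s \<ge> 0" by (simp add: s_def)
  have "s \<le> \<rho> * p"
    unfolding s_def
  proof (rule real_le_lsqrt)
    have "(\<rho> * q)\<^sup>2 \<le> b\<^sup>2" using assms by (intro power_mono) auto
    moreover have "(\<rho> * p)\<^sup>2 + (\<rho> * q)\<^sup>2 = \<rho>\<^sup>2" using assms(3) by algebra
    ultimately show "1 + r\<^sup>2 - b\<^sup>2 \<le> (\<rho> * p)\<^sup>2" using assms(9) by linarith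
  qed (use assms in auto)
  then have "R + s \<le> \<rho> * (1 + p)" using R by (simp add: algebra_simps)
  then have "(R - a) * (R + s) \<le> (\<rho> - a) * (\<rho> * (1 + p))"
    using R s0 by (intro mult_mono) auto
  also have "\<dots> = \<sigma> * \<rho> * q\<^sup>2"
  proof -
    have "(\<rho> - a) * (\<rho> * (1 + p)) = \<sigma> * \<rho> * (1 - p\<^sup>2)"
      using assms(10) by algebra
    moreover have "1 - p\<^sup>2 = q\<^sup>2" using assms(3) by simp
    ultimately show ?thesis by simp
  qed
  also have "\<dots> = (\<sigma> * q) * (\<rho> * q)" by algebra
  also have "\<dots> \<le> (\<sigma> * q) * b"
  proof -
    have "p\<^sup>2 < 1" using assms(2,3) by (smt (verit) zero_less_power2)
    then have "p < 1" using assms(1) by (simp add: power_less_one_iff)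
    then have "\<sigma> > 0" using assms(10) R by (smt (verit) mult_nonpos_nonneg)
    then show ?thesis using assms by (intro mult_left_mono) auto
  qed
  finally have "(R - a) * (R + s) / b \<le> \<sigma> * q"
    using assms(5) by (simp add: pos_divide_le_eq)
  then show ?thesis by (simp add: R_def s_def)
qed

lemma shifted_min_bound:
  fixes \<rho> \<sigma> x y p q :: real
  assumes pq: "p > 0" "q > 0" "p\<^sup>2 + q\<^sup>2 = 1" and "\<rho> > 0"
    and "y > 1" "y \<le> x" "\<rho> * p \<le> x" "\<rho> * q \<le> y" "1 + x\<^sup>2 \<le> \<rho>\<^sup>2"
    and mx: "\<rho> - \<sigma> = max (x - \<sigma> * p) (y - \<sigma> * q)"
  shows "min (x - \<sigma> * p) (y - \<sigma> * q) \<le> y * (y - 1) / (sqrt (1 + y\<^sup>2) - 1)"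
proof -
  define R where "R = sqrt (1 + x\<^sup>2)"
  define R' where "R' = sqrt (1 + y\<^sup>2)"
  define s where "s = sqrt (1 + x\<^sup>2 - y\<^sup>2)"
  have y2: "y\<^sup>2 \<le> x\<^sup>2" using assms by (simp add: power_mono)
  have sq: "R\<^sup>2 = 1 + x\<^sup>2" "R'\<^sup>2 = 1 + y\<^sup>2" "s\<^sup>2 = 1 + x\<^sup>2 - y\<^sup>2"
    using y2 by (simp_all add: R_def R'_def s_def)
  have s1: "s \<ge> 1" using y2 by (simp add: s_def)
  have R'1: "R' > 1" using assms by (simp add: R'_def)
  have RR': "R' \<le> R" using y2 by (simp add: R_def R'_def)
  have rhs: "y * (y - 1) / (sqrt (1 + y\<^sup>2) - 1) = (y - 1) * (R' + 1) / y"
    using mult_div_sqrt_minus_one[of y] assms by (simp add: R'_def)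
  consider (x) "\<rho> - \<sigma> = x - \<sigma> * p" | (y) "\<rho> - \<sigma> = y - \<sigma> * q"
    using mx by (auto simp: max_def split: if_splits)
  then show ?thesis
  proof cases
    case x
    have "min (x - \<sigma> * p) (y - \<sigma> * q) \<le> y - \<sigma> * q" by simp
    also have "\<dots> \<le> y - (R - x) * (R + s) / y"
      unfolding R_def s_def
      by (rule tangent_half_angle_bound[where p=p and \<rho>=\<rho>])
        (use assms x in \<open>auto simp: algebra_simps\<close>)
    also have "\<dots> \<le> (y - 1) * (R' + 1) / y"
    proof -
      \<comment> \<open>Here x = y would give s = 1 and R = R', hence equality. The factor (x + s)
        comes in because (x + s)(x - s) = (y - 1)(y + 1).\<close>
      have "(y + 1) * (R' + y) \<le> (x + s) * (R + x)"
        using assms s1 RR' R'1 by (intro mult_mono) auto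
      then have "(y - 1) * ((y + 1) * (R' + y)) \<le> (y - 1) * ((x + s) * (R + x))"
        using assms by (intro mult_left_mono) auto
      moreover have "(y - 1) * ((y + 1) * (R' + y)) = (x + s) * ((x - s) * (R' + y))"
        using sq by algebra
      ultimately have "(x + s) * ((x - s) * (R' + y)) \<le> (x + s) * ((y - 1) * (R + x))"
        by (simp add: algebra_simps)
      then have "(x - s) * (R' + y) \<le> (y - 1) * (R + x)"
        using assms s1 by (subst (asm) mult_le_cancel_left_pos) auto
      then have "(R' + 1) * (R + x) \<le> (R + s) * (R' + y)"
        by (simp add: algebra_simps)
      \<comment> \<open>Multiplying by the conjugates removes \<open>R + x\<close> and
        \<open>R' + y\<close>, as (R - x)(R + x) = (R' - y)(R' + y) = 1.\<close>
      then have "(R - x) * (R' - y) * ((R' + 1) * (R + x)) \<le> (R - x) * (R' - y) * ((R + s) * (R' + y))"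
      proof (rule mult_left_mono)
        have "R \<ge> x" "R' \<ge> y" by (auto simp: R_def R'_def intro!: real_le_rsqrt)
        then show "0 \<le> (R - x) * (R' - y)" by simp
      qed
      moreover have "(R - x) * (R' - y) * ((R' + 1) * (R + x)) = (R' - y) * (R' + 1)"
        "(R - x) * (R' - y) * ((R + s) * (R' + y)) = (R - x) * (R + s)"
        using sq by algebra+
      ultimately have "(R' - y) * (R' + 1) \<le> (R - x) * (R + s)" by simp
      moreover have "(y - 1) * (R' + 1) = y * y - (R' - y) * (R' + 1)"
        using sq by algebra
      ultimately show ?thesis using assms by (simp add: divide_simps)
    qed
    finally show ?thesis by (simp add: rhs)
  next
    case y
    have "min (x - \<sigma> * p) (y - \<sigma> * q) \<le> x - \<sigma> * p" by simp
    \<comment> \<open>The coordinates swap roles: \<open>y\<close> attains the maximum and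
      \<open>b\<close> is \<open>x\<close>, so the remaining leg is 1.\<close>
    also have "\<dots> \<le> x - (R - y) * (R + sqrt (1 + x\<^sup>2 - x\<^sup>2)) / x"
      unfolding R_def
      by (rule tangent_half_angle_bound[where p=q and \<rho>=\<rho>])
        (use assms y in \<open>auto simp: algebra_simps\<close>)
    also have "\<dots> = (y - 1) * ((R + 1) / x)"
    proof -
      have "x * x - (R - y) * (R + 1) = (y - 1) * (R + 1)" using sq by algebra
      then show ?thesis using assms by (simp add: divide_simps)
    qed
    also have "\<dots> \<le> (y - 1) * ((R' + 1) / y)"
    proof (rule mult_left_mono)
      \<comment> \<open>This says that R / x decreases in x.\<close>
      have "y * R \<le> x * R'"
      proof (rule power2_le_imp_le)
        show "(y * R)\<^sup>2 \<le> (x * R')\<^sup>2" using y2 by (simp add: power_mult_distrib sq algebra_simps)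
      qed (use assms R'1 in auto)
      then show "(R + 1) / x \<le> (R' + 1) / y"
        using assms by (simp add: divide_simps algebra_simps)
    qed (use assms in auto)
    finally show ?thesis by (simp add: rhs)
  qed
qed

section \<open>Geometry of a single round\<close>

text \<open>\<open>A\<close>, \<open>B\<close>, \<open>W\<close> are the inner products of l = C - L
  and w = C - M'. The hypotheses say |w - k l| <= 1 < |w - l|, and \<open>c\<close> is the larger
  root of |c w - l| = 1. Beyond the vertex B / W, |u w - l| is nondecreasing in u; comparing
  \<open>c\<close> with 1 and with A / B gives both claims.\<close>

lemma intersection_parameter_bounds:
  fixes A B W k c :: real
  assumes "A > 0" "A < B" "B\<^sup>2 \<le> A * W"
    and M: "W - 2 * k * B + k\<^sup>2 * A \<le> 1"
    and L: "W - 2 * B + A > 1"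
    and c: "c\<^sup>2 * W - 2 * c * B + A = 1" "B \<le> c * W"
  shows "A < c * B" "c < 1"
proof -
  have "W > 0" using assms(1-3) by (smt (verit) mult_nonneg_nonpos zero_less_power)
  have mono: "u\<^sup>2 * W - 2 * u * B \<le> v\<^sup>2 * W - 2 * v * B" if "B \<le> u * W" "u \<le> v" for u v
  proof -
    have "B + B \<le> u * W + v * W" using that \<open>W > 0\<close> by (smt (verit) mult_right_mono)
    then have "0 \<le> (v - u) * ((u + v) * W - 2 * B)"
      using that by (intro mult_nonneg_nonneg) (auto simp: algebra_simps)
    then show ?thesis by (simp add: algebra_simps power2_eq_square)
  qed
  have BW: "B \<le> W"
    using assms(1-3) by (smt (verit) mult_right_mono mult_less_cancel_left power2_eq_square)
  show "c < 1"
    using mono[of 1 c] BW L c by force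
  show "A < c * B"
  proof (rule ccontr)
    assume "\<not> A < c * B"
    \<comment> \<open>At u = A / B the vector u w - l is orthogonal to l, so its length is A / B < 1
      times the distance of w from the line of l. That distance is at most |w - k l| <= 1,
      contradicting the value 1 at \<open>c\<close>.\<close>
    then have "c \<le> A / B" using assms by (simp add: divide_simps mult.commute)
    from mono[OF c(2) this] have "c\<^sup>2 * W - 2 * c * B \<le> (A / B)\<^sup>2 * W - 2 * (A / B * B)"
      by (simp only: mult.assoc)
    moreover have "A / B * B = A" using assms(1,2) by simp
    ultimately have "1 \<le> (A / B)\<^sup>2 * W - A" using c(1) by linarith
    then have "1 * B\<^sup>2 \<le> ((A / B)\<^sup>2 * W - A) * B\<^sup>2" by (rule mult_right_mono) simp
    also have "\<dots> = (A / B * B)\<^sup>2 * W - A * B\<^sup>2" by algebra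
    finally have "B\<^sup>2 \<le> A * (A * W - B\<^sup>2)"
      using \<open>A / B * B = A\<close> by (simp add: power2_eq_square algebra_simps)
    moreover have "A * W - B\<^sup>2 \<le> A"
    proof -
      have "A * (W - 2 * k * B + k\<^sup>2 * A) \<le> A * 1" using M assms by (intro mult_left_mono) auto
      moreover have "A * (W - 2 * k * B + k\<^sup>2 * A) = A * W - B\<^sup>2 + (k * A - B)\<^sup>2" by algebra
      ultimately show ?thesis by (smt (verit) zero_le_power2)
    qed
    then have "A * (A * W - B\<^sup>2) \<le> A * A" using assms by (intro mult_left_mono) auto
    moreover have "A * A < B\<^sup>2" using assms by (simp add: power2_eq_square mult_strict_mono)
    ultimately show False by linarith
  qed
qed


text \<open>A nonpositive coordinate of \<open>w\<close> would leave at most |l| * |l| for the inner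
  product. The upper bounds on \<open>w\<close> come from M' in the quadrant and |C - L| = max(x,
  y).\<close>

lemma coordinates_pos_if_projection_gt_norm:
  fixes l w :: "real^2"
  assumes l: "l $ 1 > 0" "l $ 2 > 0" and w: "w $ 1 \<le> norm l" "w $ 2 \<le> norm l"
    and gt: "l \<bullet> l < l \<bullet> w"
  shows "w $ 1 > 0" "w $ 2 > 0"
proof -
  have "w $ j > 0" if "UNIV = {i, j}" "i \<noteq> j" "l $ i > 0" "l $ j > 0" "w $ i \<le> norm l" for i j
  proof (rule ccontr)
    assume "\<not> w $ j > 0"
    then have "l $ j * w $ j \<le> 0" using that by (simp add: mult_nonneg_nonpos)
    moreover have "l $ i * w $ i \<le> norm l * norm l"
      using that component_le_norm_cart[of l i] by (intro order.trans[OF mult_left_mono mult_right_mono]) auto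
    moreover have "l \<bullet> w = l $ i * w $ i + l $ j * w $ j"
      unfolding inner_vec_def that(1) using that(2) by simp
    ultimately show False using gt by (simp add: norm_eq_sqrt_inner)
  qed
  from this[of 1 2] this[of 2 1] show "w $ 1 > 0" "w $ 2 > 0"
    using assms by (auto simp: UNIV_2)
qed

lemma is_center_center:
  assumes "M \<in> quadrant" "M $ 1 < L $ 1" "M $ 2 < L $ 2"
  shows "is_center M L (center M L)"
  unfolding center_def using ex1_is_center[OF assms] by (rule theI')

lemma mcls_step:
  fixes M L M' L' :: "real^2"
  defines "C \<equiv> center M L"
  assumes M: "M \<in> quadrant" "M $ 1 < L $ 1" "M $ 2 < L $ 2" and M': "M' \<in> quadrant"
    and step: "norm (M' - M) \<le> 1" and resp: "mcls_response M L M' L'" and ne: "L' \<noteq> M'"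
  obtains c where "0 < c" "c < 1" "C - L' = c *\<^sub>R (C - M')"
    "0 < (C - M') $ 1" "0 < (C - M') $ 2" "1 + (norm (C - L))\<^sup>2 \<le> (norm (C - L'))\<^sup>2"
proof -
  define l w where "l = C - L" and "w = C - M'"
  define A B W where "A = l \<bullet> l" and "B = l \<bullet> w" and "W = w \<bullet> w"
  have "is_center M L C" unfolding C_def using M by (rule is_center_center)
  then obtain \<eta> where \<eta>: "\<eta> > 0" "C = L + \<eta> *\<^sub>R (L - M)"
    and r: "norm l = max (C $ 1) (C $ 2)"
    by (auto simp: is_center_def l_def)
  define k where "k = 1 + 1 / \<eta>"
  have "k > 1" using \<eta> by (simp add: k_def)
  have CM: "C - M = k *\<^sub>R l"
  proof -
    have "C - M = (1 + \<eta>) *\<^sub>R (L - M)" using \<eta>(2) by (simp add: scaleR_add_left)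
    moreover have "k *\<^sub>R l = (k * \<eta>) *\<^sub>R (L - M)" using \<eta>(2) by (simp add: l_def)
    moreover have "k * \<eta> = 1 + \<eta>" using \<eta>(1) by (simp add: k_def field_simps)
    ultimately show ?thesis by simp
  qed
  have l: "l $ 1 > 0" "l $ 2 > 0" using \<eta> M by (auto simp: l_def)
  then have "l \<noteq> 0" by auto
  then have A: "A > 0" by (simp add: A_def)
  have quad: "(norm (a *\<^sub>R w - b *\<^sub>R l))\<^sup>2 = a\<^sup>2 * W - 2 * a * b * B + b\<^sup>2 * A" for a b
    unfolding power2_norm_eq_inner A_def B_def W_def
    by (simp add: inner_diff_left inner_diff_right inner_commute power2_eq_square algebra_simps)
  have "w - k *\<^sub>R l = M - M'" using CM by (simp add: w_def algebra_simps)
  then have "(norm (1 *\<^sub>R w - k *\<^sub>R l))\<^sup>2 \<le> 1"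
    using step by (simp add: norm_minus_commute abs_square_le_1)
  then have Mb: "W - 2 * k * B + k\<^sup>2 * A \<le> 1" by (simp only: quad) simp
  have far: "norm (M' - L) > 1"
    using resp ne by (auto simp: mcls_response_def split: if_splits)
  have "l - w = M' - L" by (simp add: l_def w_def)
  then have "1 < (norm (1 *\<^sub>R w - 1 *\<^sub>R l))\<^sup>2"
    using far by (simp add: norm_minus_commute[of w l])
  then have Lb: "W - 2 * B + A > 1" by (simp only: quad) simp
  \<comment> \<open>M' is closer to M than to L, so it lies beyond their perpendicular bisector;
    algebraically, \<open>Lb\<close> is subtracted from \<open>Mb\<close>.\<close>
  have AB: "A < B"
  proof -
    have "(k - 1) * ((k + 1) * A - 2 * B) < 0"
      using Mb Lb by (simp add: algebra_simps power2_eq_square)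
    then have "(k + 1) * A < 2 * B" using \<open>k > 1\<close> by (simp add: mult_less_0_iff)
    moreover have "2 * A \<le> (k + 1) * A" using \<open>k > 1\<close> A by (intro mult_right_mono) auto
    ultimately show ?thesis by linarith
  qed
  have CS: "B\<^sup>2 \<le> A * W" unfolding A_def B_def W_def by (rule Cauchy_Schwarz_ineq)
  have "w \<noteq> 0" using AB A by (auto simp: B_def)
  then have W: "W > 0" by (simp add: W_def)
  define S where "S = {P \<in> affine hull {M', C}. norm (P - L) = 1}"
  have S: "L' \<in> S" "\<forall>P\<in>S. dist P C \<le> dist L' C"
    using resp far by (auto simp: mcls_response_def S_def C_def Let_def)
  obtain c where c: "C - L' = c *\<^sub>R w"
  proof -
    obtain u v where "L' = u *\<^sub>R M' + v *\<^sub>R C" "u + v = 1"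
      using S(1) by (auto simp: S_def affine_hull_2)
    then have "C - L' = u *\<^sub>R w"
      by (simp add: w_def algebra_simps flip: scaleR_add_left)
    then show ?thesis by (rule that)
  qed
  have on: "norm (C - a *\<^sub>R w - L) = 1 \<longleftrightarrow> a\<^sup>2 * W - 2 * a * B + A = 1" for a
  proof -
    have "C - a *\<^sub>R w - L = - (a *\<^sub>R w - 1 *\<^sub>R l)" by (simp add: l_def)
    then have "norm (C - a *\<^sub>R w - L) = norm (a *\<^sub>R w - 1 *\<^sub>R l)"
      by (simp only: norm_minus_cancel)
    moreover have "norm x = 1 \<longleftrightarrow> (norm x)\<^sup>2 = 1" for x :: "real^2"
      by (simp add: abs_square_eq_1)
    ultimately show ?thesis using quad[of a 1] by simp
  qed
  have L': "L' = C - c *\<^sub>R w" using c by (simp add: algebra_simps)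
  have root: "c\<^sup>2 * W - 2 * c * B + A = 1" using S(1) on[of c] L' by (simp add: S_def)
  \<comment> \<open>By Vieta this is the other intersection with the unit circle. The farther-point
    rule, with c + c' > 0, makes \<open>c\<close> the larger root.\<close>
  define c' where "c' = 2 * B / W - c"
  have "(c' - c) * (c' + c) * W = 2 * (c' - c) * B" using W by (simp add: c'_def)
  then have "c'\<^sup>2 * W - 2 * c' * B + A = 1" using root by (simp add: algebra_simps power2_eq_square)
  then have "norm (C - c' *\<^sub>R w - L) = 1" by (simp only: on)
  moreover have "C - c' *\<^sub>R w = c' *\<^sub>R M' + (1 - c') *\<^sub>R C"
    by (simp add: w_def algebra_simps)
  ultimately have "C - c' *\<^sub>R w \<in> S" unfolding S_def affine_hull_2
    by (smt (verit) mem_Collect_eq)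
  then have "dist (C - c' *\<^sub>R w) C \<le> dist L' C" using S(2) by blast
  then have "\<bar>c'\<bar> \<le> \<bar>c\<bar>" using \<open>w \<noteq> 0\<close> by (simp add: L' dist_norm)
  moreover have "c' + c > 0" using AB A W by (simp add: c'_def)
  ultimately have "c' \<le> c" by linarith
  then have Bc: "B \<le> c * W" using W by (simp add: c'_def field_simps)
  note c_bounds = intersection_parameter_bounds[OF A AB CS Mb Lb root Bc]
  show ?thesis
  proof (rule that[OF _ c_bounds(2) c[unfolded w_def]])
    show "0 < c" using c_bounds(1) A AB by (smt (verit) mult_nonpos_nonneg)
    have "w $ 1 \<le> norm l" "w $ 2 \<le> norm l"
      using M' by (auto simp: r w_def quadrant_def le_max_iff_disj)
    then show "0 < (C - M') $ 1" "0 < (C - M') $ 2"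
      using coordinates_pos_if_projection_gt_norm[of l w] l AB by (auto simp: A_def B_def w_def)
    have "(norm (C - L'))\<^sup>2 = c\<^sup>2 * W" by (simp add: c power_mult_distrib W_def power2_norm_eq_inner)
    moreover have "(norm (C - L))\<^sup>2 = A" by (simp add: power2_norm_eq_inner A_def l_def)
    ultimately show "1 + (norm (C - L))\<^sup>2 \<le> (norm (C - L'))\<^sup>2"
      using root c_bounds(1) by simp
  qed
qed

section \<open>Invariance of the relative position, and the bound\<close>

text \<open>This keeps every center well defined. The new L lies strictly between C and the new M on
  a segment along which both coordinates decrease from C.\<close>

lemma mcls_keeps_man_below:
  assumes "legal_run M L n" "admissible_start (M 0) (L 0)" "lion_plays_mcls M L n"
    "not_ended M L n" "s \<le> n"
  shows "M s $ 1 < L s $ 1 \<and> M s $ 2 < L s $ 2"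
  using \<open>s \<le> n\<close>
proof (induction s)
  case 0
  then show ?case using assms by (simp add: admissible_start_def)
next
  case (Suc s)
  define C where "C = center (M s) (L s)"
  have "s < n" using Suc by simp
  obtain c where c: "0 < c" "c < 1" "C - L (Suc s) = c *\<^sub>R (C - M (Suc s))"
    "0 < (C - M (Suc s)) $ 1" "0 < (C - M (Suc s)) $ 2"
    unfolding C_def
    by (rule mcls_step[of "M s" "L s" "M (Suc s)" "L (Suc s)"])
      (use assms Suc \<open>s < n\<close> in \<open>auto simp: legal_run_def lion_plays_mcls_def not_ended_def\<close>)
  have "C $ i - L (Suc s) $ i < C $ i - M (Suc s) $ i" if "0 < (C - M (Suc s)) $ i" for i
  proof -
    have "C $ i - L (Suc s) $ i = c * (C - M (Suc s)) $ i"
      using arg_cong[OF c(3), of "\<lambda>z. z $ i"] by simp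
    then show ?thesis using that c(2) by simp
  qed
  from this[OF c(4)] this[OF c(5)] show ?case by simp
qed

theorem theorem1:
  fixes M L :: "nat \<Rightarrow> real^2" and t :: nat
  assumes "legal_run M L (Suc t)"
    and "admissible_start (M 0) (L 0)"
    and "lion_plays_mcls M L (Suc t)"
    and "not_ended M L (Suc t)"
    and "center_min M L t > 1"
  shows "center_min M L (Suc t) \<le>
           center_min M L t * (center_min M L t - 1) / (sqrt (1 + (center_min M L t)\<^sup>2) - 1)"
proof -
  define C C' where "C = center (M t) (L t)" and "C' = center (M (Suc t)) (L (Suc t))"
  define x y where "x = C $ 1" and "y = C $ 2"
  note below = mcls_keeps_man_below[OF assms(1-4)]
  have quad: "M t \<in> quadrant" "M (Suc t) \<in> quadrant" "L (Suc t) \<in> quadrant"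
    using assms(1) by (auto simp: legal_run_def)
  obtain c where c: "0 < c" "c < 1" "C - L (Suc t) = c *\<^sub>R (C - M (Suc t))"
    "0 < (C - M (Suc t)) $ 1" "0 < (C - M (Suc t)) $ 2"
    "1 + (norm (C - L t))\<^sup>2 \<le> (norm (C - L (Suc t)))\<^sup>2"
    unfolding C_def
    by (rule mcls_step[of "M t" "L t" "M (Suc t)" "L (Suc t)"])
      (use assms below[of t] in \<open>auto simp: legal_run_def lion_plays_mcls_def not_ended_def\<close>)
  have "is_center (M t) (L t) C"
    unfolding C_def using below[of t] quad by (intro is_center_center) auto
  then have norm_C: "norm (C - L t) = max x y" by (simp add: is_center_def x_def y_def)
  have "is_center (M (Suc t)) (L (Suc t)) C'"
    unfolding C'_def using below[of "Suc t"] quad by (intro is_center_center) auto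
  then obtain \<eta> where \<eta>: "\<eta> > 0" "C' = L (Suc t) + \<eta> *\<^sub>R (L (Suc t) - M (Suc t))"
    and norm_C': "norm (C' - L (Suc t)) = max (C' $ 1) (C' $ 2)"
    by (auto simp: is_center_def)
  define \<rho> v where "\<rho> = norm (C - L (Suc t))" and "v = sgn (C - L (Suc t))"
  \<comment> \<open>The signed distance from the old center to the new one along the common line,
    measured towards the lion.\<close>
  define \<sigma> where "\<sigma> = \<rho> - norm (C' - L (Suc t))"
  have CL: "C - L (Suc t) = \<rho> *\<^sub>R v" by (cases "C - L (Suc t) = 0") (auto simp: \<rho>_def v_def sgn_div_norm)
  have CL_pos: "0 < (C - L (Suc t)) $ 1" "0 < (C - L (Suc t)) $ 2"
    using c by simp_all
  then have "C - L (Suc t) \<noteq> 0" by auto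
  then have \<rho>: "\<rho> > 0" and nv: "norm v = 1" by (simp_all add: \<rho>_def v_def norm_sgn)
  have v: "v $ 1 > 0" "v $ 2 > 0" using CL_pos \<rho> by (simp_all add: CL zero_less_mult_iff)
  have v2: "(v $ 1)\<^sup>2 + (v $ 2)\<^sup>2 = 1"
    using nv by (simp add: norm_vec_def L2_set_def UNIV_2)
  have "\<rho> * v $ i = C $ i - L (Suc t) $ i" for i
    using arg_cong[OF CL, of "\<lambda>z. z $ i"] by simp
  then have le: "\<rho> * v $ 1 \<le> x" "\<rho> * v $ 2 \<le> y"
    using quad by (simp_all add: x_def y_def quadrant_def)
  \<comment> \<open>C, L' and M' are collinear in this order, so the ray from M' through L' that
    carries the new center has direction \<open>v\<close>.\<close>
  have "C' = C - \<sigma> *\<^sub>R v"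
  proof -
    have "L (Suc t) - M (Suc t) = (1 - c) *\<^sub>R (C - M (Suc t))"
      using c(3) by (simp add: algebra_simps)
    also have "C - M (Suc t) = (\<rho> / c) *\<^sub>R v"
    proof -
      have "(\<rho> / c) *\<^sub>R v = (1 / c) *\<^sub>R (\<rho> *\<^sub>R v)" by simp
      also have "\<dots> = C - M (Suc t)" using c(1) c(3) by (simp flip: CL)
      finally show ?thesis ..
    qed
    finally have eq: "C' - L (Suc t) = (\<eta> * ((1 - c) * (\<rho> / c))) *\<^sub>R v" using \<eta> by simp
    moreover have "0 < \<eta> * ((1 - c) * (\<rho> / c))" using \<eta> \<rho> c by simp
    ultimately have "C' - L (Suc t) = norm (C' - L (Suc t)) *\<^sub>R v"
      by (simp only: norm_scaleR nv abs_of_pos mult_1_right)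
    then have "C' - L (Suc t) = (\<rho> - \<sigma>) *\<^sub>R v" by (simp add: \<sigma>_def)
    then show ?thesis using CL by (simp add: algebra_simps)
  qed
  then have C'_nth: "C' $ 1 = x - \<sigma> * v $ 1" "C' $ 2 = y - \<sigma> * v $ 2"
    by (simp_all add: x_def y_def)
  have mx: "\<rho> - \<sigma> = max (x - \<sigma> * v $ 1) (y - \<sigma> * v $ 2)"
    using norm_C' by (simp add: \<sigma>_def C'_nth)
  have \<rho>2: "1 + (max x y)\<^sup>2 \<le> \<rho>\<^sup>2" using c(6) by (simp add: norm_C \<rho>_def)
  have m: "center_min M L t = min x y"
    "center_min M L (Suc t) = min (x - \<sigma> * v $ 1) (y - \<sigma> * v $ 2)"
    unfolding center_min_def C'_nth[symmetric] by (simp_all add: C_def C'_def x_def y_def)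
  show ?thesis
  proof (cases "y \<le> x")
    case True
    then show ?thesis
      using shifted_min_bound[of "v $ 1" "v $ 2" \<rho> y x \<sigma>] v v2 \<rho> le \<rho>2 mx assms(5)
      by (simp add: m min_def max_def split: if_splits)
  next
    case False
    then show ?thesis
      using shifted_min_bound[of "v $ 2" "v $ 1" \<rho> x y \<sigma>] v v2 \<rho> le \<rho>2 mx assms(5)
      by (simp add: m min.commute max.commute add.commute min_absorb1 max_absorb2)
  qed
qed

end
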